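(* Let $D$ be a knot diagram with $n$ crossings, $n\ge 1$, and let $k$ be the smallest number such that $D$ can be converted into a virtually alternating diagram by virtualizing $k$ of its crossings. Then every optimal solution $f$ of the problem of minimizing $\mathrm{TV}(f)$ over all height functions $f$ for $D$ satisfies $\mathrm{TV}(f)=2(n-k)$. Moreover, there is an optimal height function with no more than $n-k$ local maxima and no more than $n-k$ local minima.
   Context: An $n$-crossing knot diagram $D$ (one component) is a directed 4-valent embedded planar graph with over/under information at each crossing. Its $2n$ edges are the arcs $a_0,\dots,a_{2n-1}$, numbered in the order in which they are visited when following the knot; indices are taken modulo $2n$. Each crossing is the tail crossing of exactly two arcs; at each crossing one of these two arcs is outgoing as the overarc and the other as the underarc. Let $v_0,\dots,v_{2n-1}$ be the consecutive over/undercrossings met when traversing the knot, where $v_i$ is the passage through the tail crossing of $a_i$ along the strand continuing into $a_i$. A height function for $D$ is a function $f:\{v_0,\dots,v_{2n-1}\}\to\mathbb{R}$ such that $f(v_j)-f(v_i)\ge 1$ whenever $a_i$ and $a_j$ are the two arcs outgoing from a common crossing at which $a_j$ passes over $a_i$. Its total variation is $\mathrm{TV}(f)=\sum_{i=0}^{2n-1}|f(v_{i+1})-f(v_i)|$ (indices mod $2n$). An optimal height function is one minimizing $\mathrm{TV}$ among all height functions for $D$. Virtualizing a crossing replaces it by a virtual crossing, which is neither over nor under. A diagram with ordinary and virtual crossings is virtually alternating if, when traversing the knot once around (cyclically) and ignoring all passages through virtual crossings, the passages through ordinary crossings alternate between over and under. A local maximum (respectively local minimum) of $f$ is a maximal cyclically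 consecutive run of the $v_i$ on which $f$ is constant and such that $f$ is strictly smaller (respectively strictly larger) at the neighbours immediately before and after the run. *)

theory Defs
  imports "HOL-Analysis.Analysis"
begin

text \<open>
  A diagram with \<open>n\<close> crossings is drawn in the plane \<open>\<complex>\<close> by means of \<open>2 * n\<close> paths (its arcs), listed
  in the order in which the knot visits them. Crossings are points of the plane. The passage
  \<open>v\<^sub>i\<close> is represented by the index \<open>i\<close> itself; it enters its crossing at the end of the arc with index
  \<open>i - 1\<close> and leaves along the arc with index \<open>i\<close>. The field \<open>overarc\<close> tells whether that passage is an
  overcrossing.
\<close>

record diagram =
  num_crossings :: nat
  diagram_arc :: "nat \<Rightarrow> real \<Rightarrow> complex"
  overarc :: "nat \<Rightarrow> bool"

definition num_arcs :: "diagram \<Rightarrow> nat" where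
  "num_arcs D = 2 * num_crossings D"

definition tail_crossing :: "diagram \<Rightarrow> nat \<Rightarrow> complex" where
  "tail_crossing D i = pathstart (diagram_arc D i)"

definition crossings :: "diagram \<Rightarrow> complex set" where
  "crossings D = tail_crossing D ` {..<num_arcs D}"

text \<open>
  The strand formed by the end of \<open>p\<close> and the beginning of \<open>p'\<close> crosses (rather than touches) the
  strand formed by the end of \<open>q\<close> and the beginning of \<open>q'\<close>: a homeomorphism of the plane straightens
  the two strands, near their common point, to the real and the imaginary axis. It may reverse the
  orientation, so \<open>q\<close> may cross \<open>p\<close> from either side.
\<close>

definition strands_cross ::
    "(real \<Rightarrow> complex) \<Rightarrow> (real \<Rightarrow> complex) \<Rightarrow> (real \<Rightarrow> complex) \<Rightarrow> (real \<Rightarrow> complex) \<Rightarrow> bool" where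
  "strands_cross p p' q q' \<longleftrightarrow>
     (\<exists>h k. homeomorphism (UNIV :: complex set) (UNIV :: complex set) h k \<and>
        (\<forall>\<^sub>F s in at_right 0.
           h (p (1 - s)) \<in> complex_of_real ` {..<0} \<and>
           h (p' s) \<in> complex_of_real ` {0<..} \<and>
           h (q (1 - s)) \<in> (\<lambda>r. \<i> * complex_of_real r) ` {..<0} \<and>
           h (q' s) \<in> (\<lambda>r. \<i> * complex_of_real r) ` {0<..}))"

text \<open>
  The first three conditions describe an embedded directed graph traversed by one closed walk using
  every arc once. Arcs may be loops, which \<^const>\<open>simple_path\<close> allows. Each crossing being the
  tail of exactly two arcs, it is also the head of exactly two, hence 4-valent, and there are
  \<^const>\<open>num_crossings\<close> crossings in total.
\<close>

definition knot_diagram :: "diagram \<Rightarrow> bool" where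
  "knot_diagram D \<longleftrightarrow>
     (let N = num_arcs D; a = diagram_arc D in
       (\<forall>i<N. simple_path (a i)) \<and>
       (\<forall>i<N. pathfinish (a i) = pathstart (a ((i + 1) mod N))) \<and>
       (\<forall>i<N. \<forall>j<N. i \<noteq> j \<longrightarrow>
          path_image (a i) \<inter> path_image (a j) \<subseteq>
            {pathstart (a i), pathfinish (a i)} \<inter> {pathstart (a j), pathfinish (a j)}) \<and>
       (\<forall>c\<in>crossings D. card {i. i < N \<and> tail_crossing D i = c} = 2) \<and>
       (\<forall>i<N. \<forall>j<N. i \<noteq> j \<and> tail_crossing D i = tail_crossing D j \<longrightarrow>
          overarc D i \<noteq> overarc D j \<and>
          strands_cross (a ((i + N - 1) mod N)) (a i) (a ((j + N - 1) mod N)) (a j)))"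

text \<open>
  A diagram with ordinary and virtual crossings is given by a diagram together with the set \<open>V\<close> of
  its virtualized crossings.
\<close>

definition ordinary_passages :: "diagram \<Rightarrow> complex set \<Rightarrow> nat list" where
  "ordinary_passages D V = filter (\<lambda>i. tail_crossing D i \<notin> V) [0..<num_arcs D]"

definition virtually_alternating :: "diagram \<Rightarrow> complex set \<Rightarrow> bool" where
  "virtually_alternating D V \<longleftrightarrow>
     (let P = ordinary_passages D V in
       \<forall>m<length P. overarc D (P ! m) \<noteq> overarc D (P ! ((m + 1) mod length P)))"

text \<open>
  A real function on the passages is a function on the indices; only its values at indices below
  \<^const>\<open>num_arcs\<close> matter.
\<close>

definition height_function :: "diagram \<Rightarrow> (nat \<Rightarrow> real) \<Rightarrow> bool" where
  "height_function D f \<longleftrightarrow>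
     (\<forall>i<num_arcs D. \<forall>j<num_arcs D.
        tail_crossing D i = tail_crossing D j \<and> \<not> overarc D i \<and> overarc D j \<longrightarrow> f j - f i \<ge> 1)"

definition total_variation :: "diagram \<Rightarrow> (nat \<Rightarrow> real) \<Rightarrow> real" where
  "total_variation D f = (\<Sum>i<num_arcs D. \<bar>f ((i + 1) mod num_arcs D) - f i\<bar>)"

definition optimal_height_function :: "diagram \<Rightarrow> (nat \<Rightarrow> real) \<Rightarrow> bool" where
  "optimal_height_function D f \<longleftrightarrow>
     height_function D f \<and>
     (\<forall>g. height_function D g \<longrightarrow> total_variation D f \<le> total_variation D g)"

definition cyclic_run :: "nat \<Rightarrow> nat \<Rightarrow> nat \<Rightarrow> nat set" where
  "cyclic_run N i m = (\<lambda>j. (i + j) mod N) ` {..<m}"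

text \<open>
  A local extremum is the set of indices of a run. The strict inequalities at the two neighbours make
  a constant run maximal and exclude a run through all indices.
\<close>

definition local_maxima :: "diagram \<Rightarrow> (nat \<Rightarrow> real) \<Rightarrow> nat set set" where
  "local_maxima D f =
     (let N = num_arcs D in
       {R. \<exists>i<N. \<exists>m\<in>{1..N}. R = cyclic_run N i m \<and> (\<forall>j\<in>R. f j = f i) \<and>
             f ((i + N - 1) mod N) < f i \<and> f ((i + m) mod N) < f i})"

definition local_minima :: "diagram \<Rightarrow> (nat \<Rightarrow> real) \<Rightarrow> nat set set" where
  "local_minima D f =
     (let N = num_arcs D in
       {R. \<exists>i<N. \<exists>m\<in>{1..N}. R = cyclic_run N i m \<and> (\<forall>j\<in>R. f j = f i) \<and>
             f ((i + N - 1) mod N) > f i \<and> f ((i + m) mod N) > f i})"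

end

(*
  Minimizing the total variation is linear programming dual to a network flow problem. An integral
  flow assigns to every arc a direction, up or down, such that the direction turns from up to down at
  the overpassage and from down to up at the underpassage of some crossings, and does not change at
  the passages through the set V of all other crossings: such directions exist exactly for the sets V
  whose virtualization makes the diagram alternating. Summing f(v_{i+1}) - f(v_i) with the signs of the directions gives twice the sum of
  the height differences at the crossings outside V, so TV(f) >= 2 (n - |V|) for every height
  function f and every such V. Conversely the flow problem is an assignment problem; potentials
  for an optimal assignment form a height function that is monotone along the arcs in the chosen
  directions and jumps by exactly one at the crossings outside V, so equality holds. Each of its maxima
  (minima) contains an overpassage (underpassage) of a crossing at which the direction turns.
*)

theory Submission imports Defs "HOL-Combinatorics.Combinatorics" begin

section \<open>Closed walks, potentials and duality for the assignment problem\<close>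

fun walk_weight :: "('a \<Rightarrow> 'a \<Rightarrow> real) \<Rightarrow> 'a list \<Rightarrow> real" where
  "walk_weight w (x # y # zs) = w x y + walk_weight w (y # zs)"
| "walk_weight w _ = 0"

lemma walk_weight_append:
  "walk_weight w (xs @ y # zs) = walk_weight w (xs @ [y]) + walk_weight w (y # zs)"
  by (induction xs rule: walk_weight.induct[where ?a0.0 = w]) (cases zs; simp)+

lemma walk_weight_map2: "walk_weight w xs = sum_list (map2 w xs (tl xs))"
  by (induction w xs rule: walk_weight.induct) auto

text \<open>\<open>cycle_of_list xs\<close> sends every entry to its cyclic successor, so a closed
  walk without repetitions becomes a permutation.\<close>

lemma walk_weight_cycle:
  assumes "distinct xs" "xs \<noteq> []"
  shows "walk_weight w (xs @ [hd xs]) = (\<Sum>x\<in>set xs. w x (cycle_of_list xs x))"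
proof -
  have "walk_weight w (xs @ [hd xs]) = sum_list (map2 w xs (rotate1 xs))"
    using assms zip_append1[of xs "[hd xs]" "tl xs @ [hd xs]"]
    by (cases xs) (simp_all add: walk_weight_map2)
  also have "rotate1 xs = map (cycle_of_list xs) xs"
    using cyclic_rotation[OF assms(1), of 1] by simp
  also have "map2 w xs (map (cycle_of_list xs) xs) = map (\<lambda>x. w x (cycle_of_list xs x)) xs"
    by (simp add: zip_map2 zip_same_conv_map)
  finally show ?thesis
    using assms(1) by (simp add: sum_list_distinct_conv_sum_set)
qed

text \<open>A closed walk that visits some \<open>y\<close> twice splits at \<open>y\<close> into
  two shorter closed walks. Without a repetition it is a cyclic permutation, extended to
  \<open>X\<close> by fixed points of weight zero.\<close>

lemma closed_walk_weight_nonpos: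
  assumes fin: "finite X"
    and diag: "\<And>i. i \<in> X \<Longrightarrow> w i i = 0"
    and perm: "\<And>\<sigma>. \<sigma> permutes X \<Longrightarrow> (\<Sum>i\<in>X. w i (\<sigma> i)) \<le> 0"
    and "set xs \<subseteq> X" "xs \<noteq> []"
  shows "walk_weight w (xs @ [hd xs]) \<le> 0"
  using assms(4,5)
proof (induction xs rule: length_induct)
  case (1 xs)
  show ?case
  proof (cases "distinct xs")
    case True
    let ?\<sigma> = "cycle_of_list xs"
    have "(\<Sum>i\<in>X. w i (?\<sigma> i)) = (\<Sum>i\<in>set xs. w i (?\<sigma> i))"
      using fin 1(2) diag by (intro sum.mono_neutral_right) (auto simp: id_outside_supp)
    moreover have "?\<sigma> permutes X"
      using cycle_permutes permutes_subset 1(2) by blast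
    ultimately show ?thesis
      using walk_weight_cycle[OF True 1(3), of w] perm by force
  next
    case False
    then obtain as bs cs y where xs: "xs = as @ [y] @ bs @ [y] @ cs"
      using not_distinct_decomp by blast
    \<comment> \<open>The start of the walk is \<open>y\<close> itself if \<open>as\<close> is
      empty.\<close>
    let ?h = "hd (as @ [y])"
    have hd: "hd xs = ?h" unfolding xs by (cases as) auto
    have "walk_weight w (xs @ [hd xs]) =
        walk_weight w (as @ [y]) + walk_weight w (y # bs @ [y]) + walk_weight w (y # cs @ [?h])"
      unfolding hd unfolding xs
      using walk_weight_append[of w as y "bs @ y # cs @ [?h]"]
        walk_weight_append[of w "y # bs" y "cs @ [?h]"] by simp
    also have "\<dots> = walk_weight w ((as @ y # cs) @ [hd (as @ y # cs)])
        + walk_weight w ((y # bs) @ [hd (y # bs)])"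
      using walk_weight_append[of w as y "cs @ [?h]"] by (cases as) auto
    also have "\<dots> \<le> 0 + 0"
    proof (rule add_mono)
      show "walk_weight w ((as @ y # cs) @ [hd (as @ y # cs)]) \<le> 0"
        by (rule 1(1)[rule_format]) (use 1(2) xs in auto)
      show "walk_weight w ((y # bs) @ [hd (y # bs)]) \<le> 0"
        by (rule 1(1)[rule_format]) (use 1(2) xs in auto)
    qed
    finally show ?thesis by simp
  qed
qed

text \<open>The potential of \<open>i\<close> is the supremum of the weights of all walks from a
  fixed source \<open>s\<close> to \<open>i\<close>. Appending a step extends a walk, which gives
  the inequality.\<close>

lemma exists_potential:
  assumes "finite X"
    and "\<And>i. i \<in> X \<Longrightarrow> w i i = (0::real)"
    and "\<And>\<sigma>. \<sigma> permutes X \<Longrightarrow> (\<Sum>i\<in>X. w i (\<sigma> i)) \<le> 0"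
  obtains p where "\<And>i j. i \<in> X \<Longrightarrow> j \<in> X \<Longrightarrow> p i + w i j \<le> p j"
proof (cases "X = {}")
  case True
  then show ?thesis using that[of "\<lambda>_. 0"] by simp
next
  case False
  then obtain s where s: "s \<in> X" by blast
  define W where "W i = {walk_weight w (s # xs @ [i]) | xs. set xs \<subseteq> X}" for i
  have ne: "W i \<noteq> {}" for i
    unfolding W_def by (auto intro: exI[of _ "[]"])
  \<comment> \<open>The step from \<open>i\<close> back to \<open>s\<close> closes the walk, so its
    weight is at most \<open>- w i s\<close>.\<close>
  have bdd: "bdd_above (W i)" if "i \<in> X" for i
  proof (rule bdd_aboveI[of _ "- w i s"])
    fix r assume "r \<in> W i"
    then obtain xs where xs: "set xs \<subseteq> X" "r = walk_weight w (s # xs @ [i])"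
      by (auto simp: W_def)
    have "walk_weight w ((s # xs @ [i]) @ [hd (s # xs @ [i])]) \<le> 0"
      using closed_walk_weight_nonpos[of X w "s # xs @ [i]"] assms xs s that by simp
    then show "r \<le> - w i s"
      using walk_weight_append[of w "s # xs" i "[s]"] xs by simp
  qed
  show ?thesis
  proof (rule that)
    fix i j assume ij: "i \<in> X" "j \<in> X"
    have "Sup (W i) \<le> Sup (W j) - w i j"
    proof (rule cSup_least[OF ne])
      fix r assume "r \<in> W i"
      then obtain xs where xs: "set xs \<subseteq> X" "r = walk_weight w (s # xs @ [i])"
        by (auto simp: W_def)
      have "r + w i j = walk_weight w (s # (xs @ [i]) @ [j])"
        using walk_weight_append[of w "s # xs" i "[j]"] xs by simp
      also have "\<dots> \<in> W j"
        unfolding W_def using xs(1) ij(1) by (intro CollectI exI[of _ "xs @ [i]"]) auto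
      finally show "r \<le> Sup (W j) - w i j"
        using cSup_upper[OF _ bdd[OF ij(2)]] by fastforce
    qed
    then show "Sup (W i) + w i j \<le> Sup (W j)" by simp
  qed
qed

text \<open>
  Linear programming duality for the assignment problem: rerouting \<open>\<pi>\<close> along a cycle of rows
  cannot increase the total weight, hence the gains of single reroutings admit a potential.
\<close>

lemma assignment_duality:
  fixes c :: "'a \<Rightarrow> 'a \<Rightarrow> real"
  assumes fin: "finite X" and \<pi>: "\<pi> permutes X"
    and opt: "\<And>\<sigma>. \<sigma> permutes X \<Longrightarrow> (\<Sum>i\<in>X. c i (\<sigma> i)) \<le> (\<Sum>i\<in>X. c i (\<pi> i))"
  obtains u v where "\<And>i j. i \<in> X \<Longrightarrow> j \<in> X \<Longrightarrow> c i j \<le> u i + v j"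
    and "\<And>i. i \<in> X \<Longrightarrow> c i (\<pi> i) = u i + v (\<pi> i)"
proof -
  \<comment> \<open>The gain when row \<open>i\<close> takes over the column assigned to row
    \<open>j\<close>.\<close>
  define w where "w i j = c i (\<pi> j) - c i (\<pi> i)" for i j
  have "(\<Sum>i\<in>X. w i (\<sigma> i)) \<le> 0" if "\<sigma> permutes X" for \<sigma>
    using opt[OF permutes_compose[OF that \<pi>]] by (simp add: w_def sum_subtractf)
  then obtain p where p: "\<And>i j. i \<in> X \<Longrightarrow> j \<in> X \<Longrightarrow> p i + w i j \<le> p j"
    using exists_potential[OF fin, of w] by (auto simp: w_def)
  \<comment> \<open>A column inherits the potential of the row that \<open>\<pi>\<close> assigns to
    it; the row potential is then forced by tightness.\<close>
  show ?thesis
  proof (rule that[of "\<lambda>i. c i (\<pi> i) - p i" "\<lambda>j. p (inv \<pi> j)"])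
    fix i j assume "i \<in> X" "j \<in> X"
    then show "c i j \<le> c i (\<pi> i) - p i + p (inv \<pi> j)"
      using p[of i "inv \<pi> j"] permutes_in_image[OF permutes_inv[OF \<pi>]] permutes_inverses(1)[OF \<pi>]
      by (simp add: w_def)
  next
    fix i assume "i \<in> X"
    then show "c i (\<pi> i) = c i (\<pi> i) - p i + p (inv \<pi> (\<pi> i))"
      using permutes_inverses(2)[OF \<pi>] by simp
  qed
qed

section \<open>Cyclic over/under codes; \<open>mate\<close> pairs the two passages through a
  crossing\<close>

locale gauss_code =
  fixes N :: nat and over :: "nat \<Rightarrow> bool" and mate :: "nat \<Rightarrow> nat"
  assumes N_ge_2: "2 \<le> N"
    and mate_less: "i < N \<Longrightarrow> mate i < N"
    and mate_mate: "i < N \<Longrightarrow> mate (mate i) = i"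
    and over_mate: "i < N \<Longrightarrow> over (mate i) = (\<not> over i)"
begin

definition nxt :: "nat \<Rightarrow> nat" where "nxt i = (i + 1) mod N"

definition prv :: "nat \<Rightarrow> nat" where "prv i = (i + N - 1) mod N"

lemma nxt_less: "nxt i < N" and prv_less: "prv i < N"
  using N_ge_2 by (simp_all add: nxt_def prv_def)

lemma nxt_eq: "i < N \<Longrightarrow> nxt i = (if Suc i = N then 0 else Suc i)"
  by (simp add: nxt_def)

lemma prv_eq: "i < N \<Longrightarrow> prv i = (if i = 0 then N - 1 else i - 1)"
  using N_ge_2 by (cases i) (simp_all add: prv_def)

lemma nxt_prv: "i < N \<Longrightarrow> nxt (prv i) = i"
  using N_ge_2 prv_less[of i] by (auto simp: nxt_eq prv_eq)

lemma prv_nxt: "i < N \<Longrightarrow> prv (nxt i) = i"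
  using N_ge_2 nxt_less[of i] by (auto simp: nxt_eq prv_eq split: if_splits)

lemma nxt_neq: "i < N \<Longrightarrow> nxt i \<noteq> i"
  using N_ge_2 by (auto simp: nxt_eq)

lemma mate_neq: "i < N \<Longrightarrow> mate i \<noteq> i"
  using over_mate[of i] by metis

text \<open>
  \<open>y i\<close> says that the knot goes up along the arc from \<open>i\<close> to \<open>nxt i\<close>, and \<open>S\<close> contains the passages
  at which the direction turns.
\<close>

definition orientation :: "nat set \<Rightarrow> (nat \<Rightarrow> bool) \<Rightarrow> bool" where
  "orientation S y \<longleftrightarrow>
     (\<forall>i<N. if i \<in> S then y (prv i) = over i \<and> y i = (\<not> over i) else y i = y (prv i))"

definition height :: "(nat \<Rightarrow> real) \<Rightarrow> bool" where
  "height f \<longleftrightarrow> (\<forall>i<N. over i \<longrightarrow> f i - f (mate i) \<ge> 1)"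

definition monotone_along :: "(nat \<Rightarrow> bool) \<Rightarrow> (nat \<Rightarrow> real) \<Rightarrow> bool" where
  "monotone_along y f \<longleftrightarrow> (\<forall>i<N. if y i then f i \<le> f (nxt i) else f (nxt i) \<le> f i)"

text \<open>
  The row \<open>i\<close> and the column \<open>j\<close> of this assignment problem have the potentials \<open>u i\<close> and \<open>v j\<close>;
  the height of an overpassage \<open>i\<close> is \<open>u (prv i)\<close>, and that of an underpassage \<open>j\<close> is \<open>- v j\<close>.
  An entry of weight one asks the two heights at a crossing to differ by at least one, and the
  entries of weight zero relate the heights at the ends of an arc.
\<close>

definition arc_weight :: "nat \<Rightarrow> nat \<Rightarrow> real" where
  "arc_weight i j =
     (if over (nxt i) \<and> j = mate (nxt i) then 1 else if j = i \<or> j = nxt i then 0 else - real N)"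

lemma arc_weight_le_1: "arc_weight i j \<le> 1"
  unfolding arc_weight_def by auto

text \<open>The identity has nonnegative weight. An assignment using an entry of weight
  \<open>- real N\<close> has negative weight, because the other \<open>N - 1\<close> entries
  contribute at most one each. So a maximal assignment avoids these entries.\<close>

lemma optimal_assignment:
  obtains \<pi> u v where "\<pi> permutes {..<N}"
    and "\<And>i. i < N \<Longrightarrow> \<pi> i = i \<or> \<pi> i = nxt i \<or> over (nxt i) \<and> \<pi> i = mate (nxt i)"
    and "\<And>i j. i < N \<Longrightarrow> j < N \<Longrightarrow> arc_weight i j \<le> u i + v j"
    and "\<And>i. i < N \<Longrightarrow> arc_weight i (\<pi> i) = u i + v (\<pi> i)"
proof -
  let ?w = "\<lambda>\<sigma>. \<Sum>i<N. arc_weight i (\<sigma> i)"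
  let ?P = "{\<sigma>. \<sigma> permutes {..<N}}"
  have fin: "finite ?P" by (simp add: finite_permutations)
  have "?P \<noteq> {}" using permutes_id by blast
  then obtain \<pi> where \<pi>: "\<pi> \<in> ?P" "Max (?w ` ?P) = ?w \<pi>"
    by (rule obtains_MAX[OF fin, of ?w])
  have opt: "?w \<sigma> \<le> ?w \<pi>" if "\<sigma> permutes {..<N}" for \<sigma>
    unfolding \<pi>(2)[symmetric] using fin that by (intro Max_ge) auto
  obtain u v where uv: "\<And>i j. i < N \<Longrightarrow> j < N \<Longrightarrow> arc_weight i j \<le> u i + v j"
      "\<And>i. i < N \<Longrightarrow> arc_weight i (\<pi> i) = u i + v (\<pi> i)"
    using assignment_duality[of "{..<N}" \<pi> arc_weight] \<pi>(1) opt by auto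
  have "0 \<le> ?w id"
    by (intro sum_nonneg) (simp add: arc_weight_def)
  then have nonneg: "0 \<le> ?w \<pi>" using opt[OF permutes_id] by linarith
  have supp: "\<pi> i = i \<or> \<pi> i = nxt i \<or> over (nxt i) \<and> \<pi> i = mate (nxt i)" if i: "i < N" for i
  proof (rule ccontr)
    assume "\<not> ?thesis"
    then have "arc_weight i (\<pi> i) = - real N" by (simp add: arc_weight_def)
    moreover have "?w \<pi> = arc_weight i (\<pi> i) + (\<Sum>j\<in>{..<N} - {i}. arc_weight j (\<pi> j))"
      using i by (simp add: sum.remove)
    moreover have "(\<Sum>j\<in>{..<N} - {i}. arc_weight j (\<pi> j)) \<le> (\<Sum>j\<in>{..<N} - {i}. 1)"
      by (intro sum_mono arc_weight_le_1)
    moreover have "(\<Sum>j\<in>{..<N} - {i}. 1) = real N - 1"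
      using i by (simp add: of_nat_diff)
    ultimately show False using nonneg by linarith
  qed
  show ?thesis
    by (rule that[of \<pi> u v]) (use \<pi>(1) uv supp in auto)
qed

text \<open>Directions and turning crossings are read off an optimal assignment, heights off its
  dual potentials. Entries used by the assignment are tight, which yields the jumps of exactly one
  and the monotonicity.\<close>

lemma optimal_orientation:
  obtains S y f where "S \<subseteq> {..<N}" and "\<And>i. i \<in> S \<Longrightarrow> mate i \<in> S" and "orientation S y"
    and "height f" and "\<And>i. i \<in> S \<Longrightarrow> over i \<Longrightarrow> f i - f (mate i) = 1" and "monotone_along y f"
proof -
  obtain \<pi> u v where perm: "\<pi> permutes {..<N}"
    and supp: "\<And>i. i < N \<Longrightarrow> \<pi> i = i \<or> \<pi> i = nxt i \<or> over (nxt i) \<and> \<pi> i = mate (nxt i)"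
    and le: "\<And>i j. i < N \<Longrightarrow> j < N \<Longrightarrow> arc_weight i j \<le> u i + v j"
    and eq: "\<And>i. i < N \<Longrightarrow> arc_weight i (\<pi> i) = u i + v (\<pi> i)"
    using optimal_assignment by blast
  \<comment> \<open>At a kink the arc leaves its crossing as the underarc and returns at once to
    pass over. The diagonal entry is then the entry of the crossing itself and has weight one, so
    using it means a turn; the arc goes up in any case.\<close>
  define kink where "kink i \<longleftrightarrow> over (nxt i) \<and> mate (nxt i) = i" for i
  define y where "y i \<longleftrightarrow> \<pi> i \<noteq> i \<or> kink i" for i
  define f where "f i = (if over i then u (prv i) else - v i)" for i
  \<comment> \<open>Both passages of a crossing refer to the same entry: the row before the
    overpassage and the column of the underpassage. Hence \<open>S\<close> is closed under
    \<open>mate\<close>.\<close>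
  define S where "S = {i. i < N \<and> (if over i then \<pi> (prv i) = mate i else \<pi> (prv (mate i)) = i)}"
  have inj: "\<pi> i = \<pi> j \<Longrightarrow> i = j" for i j
    using permutes_inj[OF perm] by (simp add: inj_eq)
  have column: "\<pi> j = j \<or> \<pi> (prv j) = j \<or> \<not> over j \<and> \<pi> (prv (mate j)) = j" if j: "j < N" for j
  proof -
    obtain i where i: "i < N" "\<pi> i = j"
      using j permutes_image[OF perm] by (metis imageE lessThan_iff)
    consider "j = i" | "j = nxt i" | "over (nxt i)" "j = mate (nxt i)"
      using supp[OF i(1)] i(2) by blast
    then show ?thesis
    proof cases
      case 3
      then show ?thesis using i nxt_less[of i] mate_mate over_mate prv_nxt by auto
    qed (use i prv_nxt in auto)
  qed
  have w0: "arc_weight i i \<ge> 0" "arc_weight i (nxt i) \<ge> 0" for i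
    by (auto simp: arc_weight_def)
  have uv0: "u i \<ge> - v i" "u i \<ge> - v (nxt i)" if "i < N" for i
    using le[of i i] le[of i "nxt i"] w0[of i] nxt_less[of i] that by auto
  \<comment> \<open>Tightness of the used entries of weight zero; a diagonal entry at a kink has
    weight one and is excluded.\<close>
  have stay: "u i = - v i" if "i < N" "\<pi> i = i" "\<not> kink i" for i
    using eq[of i] that by (auto simp: arc_weight_def kink_def)
  have move: "u i = - v (nxt i)" if "i < N" "\<pi> i = nxt i" for i
    using eq[of i] that mate_neq[OF nxt_less, of i] by (auto simp: arc_weight_def)
  have S_mate: "mate i \<in> S" if "i \<in> S" for i
    using that mate_less[of i] mate_mate[of i] over_mate[of i] by (auto simp: S_def)
  have "height f"
    unfolding height_def
  proof (intro allI impI)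
    fix i assume i: "i < N" "over i"
    have "1 \<le> u (prv i) + v (mate i)"
      using le[OF prv_less mate_less[OF i(1)], of i] i by (simp add: arc_weight_def nxt_prv)
    then show "f i - f (mate i) \<ge> 1"
      using i over_mate by (simp add: f_def)
  qed
  moreover have "f i - f (mate i) = 1" if "i \<in> S" "over i" for i
    using eq[OF prv_less, of i] that over_mate by (simp add: f_def S_def arc_weight_def nxt_prv)
  moreover have "monotone_along y f"
    unfolding monotone_along_def
  proof (intro allI impI)
    fix i assume i: "i < N"
    have row: "\<pi> i = i \<or> \<pi> i = nxt i" if "\<not> over (nxt i)"
      using supp[OF i] that by blast
    have col: "\<pi> i = i \<or> \<pi> (prv i) = i" if "over i"
      using column[OF i] that by blast
    have uv1: "u (prv i) \<ge> - v i" using uv0(2)[OF prv_less, of i] i by (simp add: nxt_prv)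
    have up: "u (prv i) = - v i" if "\<pi> (prv i) = i"
      using move[OF prv_less, of i] that i by (simp add: nxt_prv)
    have nk: "\<not> kink i" if "\<not> over (nxt i) \<or> over i"
      using that over_mate[OF nxt_less, of i] by (auto simp: kink_def)
    show "if y i then f i \<le> f (nxt i) else f (nxt i) \<le> f i"
    proof (cases "\<pi> i = i")
      case True
      show ?thesis
      proof (cases "kink i")
        case True
        then show ?thesis using uv0[OF i] nk prv_nxt[OF i] by (auto simp: y_def f_def)
      next
        case False
        then show ?thesis
          using True uv0[OF i] uv1 stay[OF i] prv_nxt[OF i] by (auto simp: y_def f_def)
      qed
    next
      case False
      then show ?thesis
        using uv0[OF i] row col move[OF i] up prv_nxt[OF i] by (auto simp: y_def f_def)
    qed
  qed
  moreover have "orientation S y"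
  proof -
    \<comment> \<open>Conservation at one crossing. Column \<open>i\<close> can be filled only from
      rows \<open>i\<close> and \<open>?a\<close>, column \<open>?m\<close> only from
      \<open>?m\<close>, \<open>?b\<close> and \<open>?a\<close>. If \<open>?a\<close> takes
      \<open>?m\<close>, the other choices are forced and both strands turn; otherwise each strand
      keeps its direction.\<close>
    have "if \<pi> (prv i) = mate i then y (prv i) \<and> \<not> y i \<and> \<not> y (prv (mate i)) \<and> y (mate i)
      else y i = y (prv i) \<and> y (mate i) = y (prv (mate i))" if i: "i < N" "over i" for i
    proof -
      let ?a = "prv i" and ?m = "mate i" and ?b = "prv (mate i)"
      have m: "?m < N" "\<not> over ?m" "mate ?m = i" using i mate_less over_mate mate_mate by auto
      have a: "nxt ?a = i" and b: "nxt ?b = ?m" using i m nxt_prv by auto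
      have kink_a: "kink ?a \<longleftrightarrow> ?m = ?a" using i a by (simp add: kink_def)
      have kink_i: "\<not> kink i" using i over_mate[OF nxt_less, of i] by (auto simp: kink_def)
      have kink_b: "\<not> kink ?b" using m b by (simp add: kink_def)
      have kink_m: "kink ?m \<longleftrightarrow> nxt ?m = i"
        using m mate_mate[OF nxt_less, of ?m] i(2) by (metis kink_def)
      have kink_am: "kink ?m \<longleftrightarrow> ?m = ?a" using kink_m prv_nxt[OF m(1)] a by metis
      have neq: "i \<noteq> ?m" "?a \<noteq> i" "?b \<noteq> ?m"
        using i m a b nxt_neq[OF i(1)] nxt_neq[OF m(1)] by metis+
      have ab: "?a \<noteq> ?b" using a b neq(1) by metis
      have ys: "y ?a \<longleftrightarrow> \<pi> ?a \<noteq> ?a \<or> ?m = ?a" "y i \<longleftrightarrow> \<pi> i \<noteq> i"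
        "y ?b \<longleftrightarrow> \<pi> ?b \<noteq> ?b" "y ?m \<longleftrightarrow> \<pi> ?m \<noteq> ?m \<or> ?m = ?a"
        unfolding y_def using kink_a kink_i kink_b kink_am by blast+
      have ra: "\<pi> ?a = ?a \<or> \<pi> ?a = i \<or> \<pi> ?a = ?m"
        using supp[OF prv_less, of i] unfolding a by blast
      have rb: "\<pi> ?b = ?b \<or> \<pi> ?b = ?m"
        using supp[OF prv_less, of ?m] m(2) unfolding b by blast
      have ci: "\<pi> i = i \<or> \<pi> ?a = i"
        using column[OF i(1)] i(2) by blast
      have cm: "\<pi> ?m = ?m \<or> \<pi> ?b = ?m \<or> \<pi> ?a = ?m"
        using column[OF m(1)] unfolding m(3) by blast
      show ?thesis
      proof (cases "\<pi> ?a = ?m")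
        case True
        then have "\<pi> i = i" "\<pi> ?b = ?b" "\<pi> ?m = ?m \<longrightarrow> ?m = ?a"
          using ci rb neq ab inj[of ?a ?b] inj[of ?a ?m] by metis+
        then show ?thesis using True ys by metis
      next
        case False
        then have "\<pi> i = i \<longleftrightarrow> \<pi> ?a = ?a \<and> ?m \<noteq> ?a" "\<pi> ?m = ?m \<and> ?m \<noteq> ?a \<longleftrightarrow> \<pi> ?b = ?b"
          using ra rb ci cm neq ab inj[of ?a i] inj[of ?b ?m] by metis+
        then show ?thesis using False ys by metis
      qed
    qed
    note turn = this
    show ?thesis
      unfolding orientation_def
    proof (intro allI impI)
      fix i assume i: "i < N"
      show "if i \<in> S then y (prv i) = over i \<and> y i = (\<not> over i) else y i = y (prv i)"
      proof (cases "over i")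
        case True
        then show ?thesis using turn[OF i] i by (auto simp: S_def split: if_splits)
      next
        case False
        then show ?thesis
          using turn[OF mate_less[OF i]] i by (auto simp: S_def over_mate mate_mate split: if_splits)
      qed
    qed
  qed
  ultimately show ?thesis
    using that[of S y f] S_mate by (auto simp: S_def)
qed

end

section \<open>Total variation and its lower bound\<close>

context gauss_code begin

lemma bij_betw_prv: "bij_betw prv {..<N} {..<N}"
  by (rule bij_betw_byWitness[where f' = nxt]) (auto simp: nxt_prv prv_nxt nxt_less prv_less)

definition variation :: "(nat \<Rightarrow> real) \<Rightarrow> real" where
  "variation f = (\<Sum>i<N. \<bar>f (nxt i) - f i\<bar>)"

text \<open>Summation by parts: the coefficient of \<open>f i\<close> is the change of the sign of
  the direction at \<open>i\<close>, namely 2 at overpassages in \<open>S\<close>, -2 at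
  underpassages in \<open>S\<close> and 0 elsewhere. \<open>mate\<close> then pairs the terms
  crossing by crossing.\<close>

lemma signed_variation:
  assumes "S \<subseteq> {..<N}" and mate_S: "\<And>i. i \<in> S \<Longrightarrow> mate i \<in> S" and y: "orientation S y"
  shows "(\<Sum>i<N. (if y i then 1 else -1) * (f (nxt i) - f i)) =
    2 * (\<Sum>i | i \<in> S \<and> over i. f i - f (mate i) :: real)"
proof -
  define e where "e i = (if y i then 1 else -1 :: real)" for i
  have fin: "finite S" using assms(1) finite_subset by blast
  have "(\<Sum>i<N. e i * (f (nxt i) - f i)) = (\<Sum>i<N. e i * f (nxt i)) - (\<Sum>i<N. e i * f i)"
    by (simp add: algebra_simps sum_subtractf)
  also have "(\<Sum>i<N. e i * f (nxt i)) = (\<Sum>i<N. e (prv i) * f i)"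
    by (subst sum.reindex_bij_betw[OF bij_betw_prv, symmetric]) (auto intro!: sum.cong simp: nxt_prv)
  also have "(\<Sum>i<N. e (prv i) * f i) - (\<Sum>i<N. e i * f i) = (\<Sum>i<N. (e (prv i) - e i) * f i)"
    by (simp add: algebra_simps sum_subtractf)
  also have "\<dots> = (\<Sum>i\<in>S. (if over i then 2 else -2) * f i)"
  proof (rule sum.mono_neutral_cong_right)
    show "\<forall>i\<in>{..<N} - S. (e (prv i) - e i) * f i = 0"
      using y by (auto simp: orientation_def e_def)
    show "(e (prv i) - e i) * f i = (if over i then 2 else -2) * f i" if "i \<in> S" for i
      using y assms(1) that by (auto simp: orientation_def e_def)
  qed (use assms(1) in auto)
  also have "\<dots> = (\<Sum>i | i \<in> S \<and> over i. 2 * f i) + (\<Sum>i | i \<in> S \<and> \<not> over i. -2 * f i)"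
  proof -
    have "S = {i. i \<in> S \<and> over i} \<union> {i. i \<in> S \<and> \<not> over i}" by blast
    then have "(\<Sum>i\<in>S. (if over i then 2 else -2) * f i) =
      (\<Sum>i\<in>{i. i \<in> S \<and> over i} \<union> {i. i \<in> S \<and> \<not> over i}. (if over i then 2 else -2) * f i)"
      by simp
    also have "\<dots> = (\<Sum>i | i \<in> S \<and> over i. (if over i then 2 else -2) * f i)
        + (\<Sum>i | i \<in> S \<and> \<not> over i. (if over i then 2 else -2) * f i)"
      using fin by (intro sum.union_disjoint) auto
    finally show ?thesis by simp
  qed
  also have "(\<Sum>i | i \<in> S \<and> \<not> over i. -2 * f i) = (\<Sum>i | i \<in> S \<and> over i. -2 * f (mate i))"
    by (rule sum.reindex_bij_witness[where i = mate and j = mate])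
      (use assms(1) mate_S mate_mate over_mate in \<open>auto simp: subset_eq\<close>)
  finally show ?thesis
    unfolding e_def by (simp add: sum.distrib[symmetric] sum_distrib_left algebra_simps)
qed

text \<open>Weak duality: signed increments are at most their absolute values, and each turning
  crossing contributes at least one height difference of one.\<close>

lemma variation_ge:
  assumes "S \<subseteq> {..<N}" "\<And>i. i \<in> S \<Longrightarrow> mate i \<in> S" "orientation S y" "height f"
  shows "2 * real (card {i \<in> S. over i}) \<le> variation f"
proof -
  have "real (card {i \<in> S. over i}) = (\<Sum>i | i \<in> S \<and> over i. 1)" by simp
  also have "\<dots> \<le> (\<Sum>i | i \<in> S \<and> over i. f i - f (mate i))"
    using assms(1,4) by (intro sum_mono) (auto simp: height_def)
  finally have "2 * real (card {i \<in> S. over i}) \<le>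
      (\<Sum>i<N. (if y i then 1 else -1) * (f (nxt i) - f i))"
    using signed_variation[OF assms(1-3), of f] by simp
  also have "\<dots> \<le> variation f"
    unfolding variation_def by (intro sum_mono) auto
  finally show ?thesis .
qed

text \<open>Both estimates behind the lower bound become equalities.\<close>

lemma variation_eq:
  assumes "S \<subseteq> {..<N}" "\<And>i. i \<in> S \<Longrightarrow> mate i \<in> S" "orientation S y" "monotone_along y f"
    and "\<And>i. i \<in> S \<Longrightarrow> over i \<Longrightarrow> f i - f (mate i) = 1"
  shows "variation f = 2 * real (card {i \<in> S. over i})"
proof -
  have "variation f = (\<Sum>i<N. (if y i then 1 else -1) * (f (nxt i) - f i))"
    unfolding variation_def using assms(4) by (intro sum.cong) (auto simp: monotone_along_def)
  also have "\<dots> = 2 * (\<Sum>i | i \<in> S \<and> over i. 1)"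
    using signed_variation[OF assms(1-3), of f] assms(5) by simp
  finally show ?thesis by simp
qed

lemma card_over: "2 * card {i. i < N \<and> over i} = N"
proof -
  have "card {i. i < N \<and> over i} = card {i. i < N \<and> \<not> over i}"
    by (rule bij_betw_same_card, rule bij_betw_byWitness[where f = mate and f' = mate])
      (auto simp: mate_less mate_mate over_mate)
  moreover have "card {i. i < N \<and> over i} + card {i. i < N \<and> \<not> over i} =
      card ({i. i < N \<and> over i} \<union> {i. i < N \<and> \<not> over i})"
    by (intro card_Un_disjoint[symmetric]) auto
  moreover have "{i. i < N \<and> over i} \<union> {i. i < N \<and> \<not> over i} = {..<N}" by auto
  ultimately show ?thesis by simp
qed

section \<open>Local maxima; the minima of \<open>f\<close> are handled as maxima of
  \<open>- f\<close>\<close>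

definition run_maxima :: "(nat \<Rightarrow> real) \<Rightarrow> nat set set" where
  "run_maxima f =
     {R. \<exists>i<N. \<exists>m\<in>{1..N}. R = cyclic_run N i m \<and> (\<forall>j\<in>R. f j = f i) \<and>
           f (prv i) < f i \<and> f ((i + m) mod N) < f i}"

lemma nxt_mod: "nxt (i mod N) = Suc i mod N"
  unfolding nxt_def by (simp add: mod_Suc_eq)

lemma mod_add_right_cancel: "(i + a) mod N = (j + a) mod N \<Longrightarrow> i mod N = j mod N"
proof (induction a)
  case (Suc a)
  have "nxt ((i + a) mod N) = nxt ((j + a) mod N)"
    using Suc.prems unfolding nxt_mod add_Suc_right .
  then have "(i + a) mod N = (j + a) mod N"
    using prv_nxt N_ge_2 by (metis mod_less_divisor pos2 less_le_trans)
  then show ?case by (rule Suc.IH)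
qed simp

text \<open>If \<open>a < a'\<close>, the run from \<open>i'\<close> starts before \<open>i\<close>
  and contains \<open>prv i\<close>, where \<open>f\<close> is strictly smaller than at the common
  passage.\<close>

lemma run_start_unique:
  fixes f :: "nat \<Rightarrow> real"
  assumes "(i + a) mod N = (i' + a') mod N" "a \<le> a'" "a' < m'"
    and "i < N" "i' < N"
    and "\<forall>j\<in>cyclic_run N i' m'. f j = f i'" "f (prv i) < f ((i + a) mod N)"
  shows "a = a' \<and> i = i'"
proof -
  have c: "(i + a) mod N = (i' + (a' - a) + a) mod N" using assms(1,2) by simp
  have i: "i mod N = (i' + (a' - a)) mod N"
    using c by (rule mod_add_right_cancel)
  have "a = a'"
  proof (rule ccontr)
    assume "a \<noteq> a'"
    define d where "d = a' - a - 1"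
    have d: "a' - a = Suc d" "d < m'" using \<open>a \<noteq> a'\<close> assms(2,3) by (auto simp: d_def)
    have "i = nxt ((i' + d) mod N)" using i assms(4) d(1) by (simp add: nxt_mod)
    then have "prv i = (i' + d) mod N" using N_ge_2 by (simp add: prv_nxt)
    then have "f (prv i) = f i'" using assms(6) d(2) by (auto simp: cyclic_run_def)
    moreover have "f ((i + a) mod N) = f i'"
      using assms(1,3,6) by (auto simp: cyclic_run_def)
    ultimately show False using assms(7) by simp
  qed
  then show ?thesis using i assms(4,5) by simp
qed

text \<open>Runs sharing a passage start together; a longer one would contain the passage just after
  the shorter one, where \<open>f\<close> has already dropped.\<close>

lemma run_maxima_disjoint:
  assumes "R \<in> run_maxima f" "R' \<in> run_maxima f" "x \<in> R" "x \<in> R'"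
  shows "R = R'"
proof -
  obtain i m where i: "i < N" "R = cyclic_run N i m" "\<forall>j\<in>R. f j = f i" "f (prv i) < f i"
      "f ((i + m) mod N) < f i"
    using assms(1) by (auto simp: run_maxima_def)
  obtain i' m' where i': "i' < N" "R' = cyclic_run N i' m'" "\<forall>j\<in>R'. f j = f i'" "f (prv i') < f i'"
      "f ((i' + m') mod N) < f i'"
    using assms(2) by (auto simp: run_maxima_def)
  obtain a where a: "a < m" "x = (i + a) mod N" using assms(3) i by (auto simp: cyclic_run_def)
  obtain a' where a': "a' < m'" "x = (i' + a') mod N" using assms(4) i' by (auto simp: cyclic_run_def)
  have fx: "f x = f i" "f x = f i'" using assms(3,4) i(3) i'(3) by blast+
  have xx: "(i + a) mod N = (i' + a') mod N" using a a' by simp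
  have run: "\<forall>j\<in>cyclic_run N i m. f j = f i" "\<forall>j\<in>cyclic_run N i' m'. f j = f i'"
    using i(2,3) i'(2,3) by blast+
  have lt: "f (prv i) < f ((i + a) mod N)" "f (prv i') < f ((i' + a') mod N)"
    using i(4) i'(4) fx a(2) a'(2) by metis+
  have eq: "i = i'"
  proof (cases "a \<le> a'")
    case True
    show ?thesis
      using run_start_unique[OF xx True a'(1) i(1) i'(1) run(2) lt(1)] by blast
  next
    case False
    then have "a' \<le> a" by simp
    then show ?thesis
      using run_start_unique[OF xx[symmetric] _ a(1) i'(1) i(1) run(1) lt(2)] by blast
  qed
  have "\<not> m < m'"
  proof
    assume "m < m'"
    then have "f ((i + m) mod N) = f i" using run(2) eq unfolding cyclic_run_def by blast
    then show False using i(5) by simp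
  qed
  moreover have "\<not> m' < m"
  proof
    assume "m' < m"
    then have "f ((i' + m') mod N) = f i'" using run(1) eq unfolding cyclic_run_def by blast
    then show False using i'(5) by simp
  qed
  ultimately have "m = m'" by simp
  then show ?thesis using i(2) i'(2) eq by simp
qed

text \<open>Every maximum contains a passage of \<open>T\<close>: otherwise the upward direction of
  its entry would persist to its end, against the descent there. As maxima are disjoint, choosing
  such a passage is injective.\<close>

lemma card_run_maxima_le:
  assumes "finite T" and y: "\<And>i. i < N \<Longrightarrow> if y i then f i \<le> f (nxt i) else f (nxt i) \<le> f i"
    and T: "\<And>i. i < N \<Longrightarrow> y (prv i) \<Longrightarrow> \<not> y i \<Longrightarrow> i \<in> T"
  shows "card (run_maxima f) \<le> card T"
proof -
  have hit: "\<exists>x. x \<in> R \<and> x \<in> T" if R: "R \<in> run_maxima f" for R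
  proof (rule ccontr)
    assume no: "\<not> ?thesis"
    obtain i m where i: "i < N" "1 \<le> m" "R = cyclic_run N i m" "\<forall>j\<in>R. f j = f i"
        "f (prv i) < f i" "f ((i + m) mod N) < f i"
      using R by (auto simp: run_maxima_def)
    have up: "y ((i + a) mod N)" if "a < m" for a
      using that
    proof (induction a)
      case 0
      have "y (prv i)" using y[OF prv_less, of i] i(1,5) by (auto simp: nxt_prv split: if_splits)
      moreover have "i \<notin> T" using no i(1,2,3) by (force simp: cyclic_run_def)
      ultimately show ?case using T[OF i(1)] i(1) by auto
    next
      case (Suc a)
      let ?x = "(i + Suc a) mod N"
      have x: "?x < N" using N_ge_2 by simp
      have "?x = nxt ((i + a) mod N)" by (simp add: nxt_mod)
      then have "prv ?x = (i + a) mod N" using N_ge_2 by (simp add: prv_nxt)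
      moreover have "?x \<notin> T" using no i(3) Suc.prems unfolding cyclic_run_def by blast
      ultimately show ?case using T[OF x] Suc by auto
    qed
    define x where "x = (i + (m - 1)) mod N"
    have "f x \<le> f (nxt x)"
      using y[of x] up[of "m - 1"] i(2) N_ge_2 by (auto simp: x_def)
    moreover have "nxt x = (i + m) mod N" using i(2) by (simp add: x_def nxt_mod)
    moreover have "x \<in> R"
      unfolding x_def i(3) cyclic_run_def using i(2) by (intro imageI) simp
    then have "f x = f i" using i(4) by blast
    ultimately show False using i(6) by simp
  qed
  then obtain g where g: "\<And>R. R \<in> run_maxima f \<Longrightarrow> g R \<in> R \<and> g R \<in> T"
    by metis
  show ?thesis
  proof (rule card_inj_on_le[of g])
    show "inj_on g (run_maxima f)"
      using g run_maxima_disjoint by (metis inj_onI)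
  qed (use g assms(1) in auto)
qed

end

section \<open>Alternating codes and orientations\<close>

lemma filter_upt_nth:
  assumes "m < length (filter Q [0..<N])"
  shows "filter Q [0..<filter Q [0..<N] ! m] = take m (filter Q [0..<N])"
proof -
  let ?P = "filter Q [0..<N]"
  define i where "i = ?P ! m"
  have "i \<in> set ?P" unfolding i_def using assms by (rule nth_mem)
  then have i: "i < N" "Q i" by auto
  have "[0..<N] = [0..<i] @ i # [Suc i..<N]"
    using i(1) upt_add_eq_append[of 0 i "N - i"] by (simp add: upt_conv_Cons)
  then have P: "?P = filter Q [0..<i] @ i # filter Q [Suc i..<N]"
    using i(2) by (metis filter.simps(2) filter_append)
  then have "?P ! length (filter Q [0..<i]) = ?P ! m"
    by (metis i_def nth_append_length)
  moreover have "length (filter Q [0..<i]) < length ?P"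
    using P by (metis length_append length_Cons less_add_Suc1 add_Suc_right)
  ultimately have "length (filter Q [0..<i]) = m"
    using assms by (simp add: nth_eq_iff_index_eq)
  then show ?thesis
    using P by (metis append_eq_conv_conj i_def)
qed

context gauss_code begin

definition alternating :: "nat set \<Rightarrow> bool" where
  "alternating S \<longleftrightarrow>
     (let P = filter (\<lambda>i. i \<in> S) [0..<N] in
       \<forall>m<length P. over (P ! m) \<noteq> over (P ! ((m + 1) mod length P)))"

text \<open>
  The direction in which the passage \<open>K\<close> is entered, as read off the last passage in \<open>S\<close> before it;
  it is cyclic, so the last passage in \<open>S\<close> of all counts as preceding the first one.
\<close>

definition direction :: "nat set \<Rightarrow> nat \<Rightarrow> bool" where
  "direction S K =
     (let P = filter (\<lambda>i. i \<in> S) [0..<N]; Q = filter (\<lambda>i. i \<in> S) [0..<K]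
      in \<not> over (if Q = [] then last P else last Q))"

lemma direction_Suc: "direction S (Suc i) = (if i \<in> S then \<not> over i else direction S i)"
  by (simp add: direction_def)

lemma direction_cyclic: "direction S N = direction S 0"
  by (simp add: direction_def)

text \<open>The direction at the cyclic successor of an ordinary passage is opposite to
  \<open>over\<close> of that passage, and every ordinary passage is such a successor.\<close>

lemma alternating_iff_direction:
  assumes "S \<subseteq> {..<N}"
  shows "alternating S \<longleftrightarrow> (\<forall>i\<in>S. direction S i = over i)"
proof -
  define P where "P = filter (\<lambda>i. i \<in> S) [0..<N]"
  have set_P: "set P = S" using assms by (auto simp: P_def)
  have dir: "direction S (P ! ((m + 1) mod length P)) = (\<not> over (P ! m))" if m: "m < length P" for m
  proof -
    define m' where "m' = (m + 1) mod length P"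
    have m': "m' < length P" unfolding m'_def using m by (intro mod_less_divisor) linarith
    have take: "filter (\<lambda>i. i \<in> S) [0..<P ! m'] = take m' P"
      using filter_upt_nth m' unfolding P_def by blast
    have "direction S (P ! m') = (\<not> over (if take m' P = [] then last P else last (take m' P)))"
      unfolding direction_def Let_def take P_def[symmetric] ..
    also have "(if take m' P = [] then last P else last (take m' P)) = P ! m"
    proof (cases "m + 1 = length P")
      case True
      then have "m' = 0" "P \<noteq> []" by (auto simp: m'_def)
      moreover have "length P - 1 = m" using True by simp
      ultimately show ?thesis by (simp add: last_conv_nth)
    next
      case False
      then have "m' = Suc m" using m by (simp add: m'_def)
      then show ?thesis using m by (simp add: take_Suc_conv_app_nth)
    qed
    finally show ?thesis unfolding m'_def .
  qed
  have onto: "\<exists>m<length P. i = P ! ((m + 1) mod length P)" if i: "i \<in> S" for i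
  proof -
    obtain l where l: "l < length P" "i = P ! l"
      using i set_P by (metis in_set_conv_nth)
    show ?thesis
    proof (cases l)
      case 0
      then show ?thesis using l by (intro exI[of _ "length P - 1"]) auto
    next
      case (Suc m)
      then show ?thesis using l by (intro exI[of _ m]) auto
    qed
  qed
  show ?thesis
  proof
    assume alt: "alternating S"
    show "\<forall>i\<in>S. direction S i = over i"
    proof
      fix i assume "i \<in> S"
      then obtain m where m: "m < length P" "i = P ! ((m + 1) mod length P)" using onto by blast
      have "over (P ! m) \<noteq> over i"
        using alt m unfolding alternating_def Let_def P_def[symmetric] by blast
      then show "direction S i = over i" using dir[OF m(1)] m(2) by simp
    qed
  next
    assume *: "\<forall>i\<in>S. direction S i = over i"
    show "alternating S"
      unfolding alternating_def Let_def P_def[symmetric]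
    proof (intro allI impI)
      fix m assume m: "m < length P"
      then have "(m + 1) mod length P < length P" by (intro mod_less_divisor) linarith
      then have "P ! ((m + 1) mod length P) \<in> S" using set_P nth_mem by blast
      then show "over (P ! m) \<noteq> over (P ! ((m + 1) mod length P))"
        using * dir[OF m] by blast
    qed
  qed
qed

text \<open>In any orientation the last passage in \<open>S\<close> before an arc determines its
  direction. Conversely, for an alternating code this rule defines an orientation.\<close>

lemma alternating_iff_orientation:
  assumes S: "S \<subseteq> {..<N}"
  shows "alternating S \<longleftrightarrow> (\<exists>y. orientation S y)"
proof
  assume alt: "alternating S"
  \<comment> \<open>For \<open>i = 0\<close> the entering arc is the last one, and
    \<open>direction_cyclic\<close> closes the circle.\<close>
  have entry: "direction S (Suc (prv i)) = direction S i" if "i < N" for i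
    using that direction_cyclic by (cases i) (simp_all add: prv_eq)
  have "orientation S (\<lambda>i. direction S (Suc i))"
    unfolding orientation_def
  proof (intro allI impI)
    fix i assume i: "i < N"
    show "if i \<in> S then direction S (Suc (prv i)) = over i \<and> direction S (Suc i) = (\<not> over i)
      else direction S (Suc i) = direction S (Suc (prv i))"
      using alt unfolding entry[OF i] alternating_iff_direction[OF S]
      by (simp only: direction_Suc if_True if_False split: if_split) blast
  qed
  then show "\<exists>y. orientation S y" by blast
next
  assume "\<exists>y. orientation S y"
  then obtain y where y: "orientation S y" by blast
  let ?Q = "\<lambda>K. filter (\<lambda>i. i \<in> S) [0..<K]"
  have prv_Suc: "prv (Suc i) = i" if "i < N" for i
    using that by (simp add: prv_def)
  have prv_N: "prv N = prv 0"
    using N_ge_2 prv_Suc[of "N - 1"] by (simp add: prv_eq)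
  \<comment> \<open>Before the first passage in \<open>S\<close> the direction is still that of the
    arc entering 0. Since \<open>prv N = prv 0\<close>, the case \<open>K = N\<close> determines
    it.\<close>
  have state: "y (prv K) = (if ?Q K = [] then y (prv 0) else \<not> over (last (?Q K)))" if "K \<le> N" for K
    using that
  proof (induction K)
    case (Suc i)
    have i: "i < N" using Suc.prems by simp
    show ?case
    proof (cases "i \<in> S")
      case True
      then have "y i = (\<not> over i)" using y i unfolding orientation_def by metis
      then show ?thesis using True i by (simp add: prv_Suc)
    next
      case False
      then have "y i = y (prv i)" using y i unfolding orientation_def by metis
      then show ?thesis using False i Suc.IH by (simp add: prv_Suc)
    qed
  qed simp
  show "alternating S"
    unfolding alternating_iff_direction[OF S]
  proof
    fix i assume i: "i \<in> S"
    then have iN: "i < N" using S by blast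
    have "?Q N \<noteq> []" using i iN by (auto simp: filter_empty_conv)
    then have "y (prv 0) = (\<not> over (last (?Q N)))" using state[of N] prv_N by simp
    then have "y (prv i) = direction S i"
      using state[of i] iN by (simp add: direction_def)
    then show "direction S i = over i" using y i iN unfolding orientation_def by metis
  qed
qed

lemma mate_closed_card:
  assumes "S \<subseteq> {..<N}" "\<And>i. i \<in> S \<Longrightarrow> mate i \<in> S"
  shows "card {i \<in> S. \<not> over i} = card {i \<in> S. over i}"
  by (rule bij_betw_same_card, rule bij_betw_byWitness[where f = mate and f' = mate])
    (use assms in \<open>auto simp: mate_mate over_mate subset_eq\<close>)

text \<open>
  Passing through a maximum, the direction turns from up to down, which happens only at an
  overpassage in \<open>S\<close>; dually for minima.
\<close>

lemma card_extrema_le: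
  assumes "S \<subseteq> {..<N}" "\<And>i. i \<in> S \<Longrightarrow> mate i \<in> S" "orientation S y" "monotone_along y f"
  shows "card (run_maxima f) \<le> card {i \<in> S. over i}"
    and "card (run_maxima (\<lambda>i. - f i)) \<le> card {i \<in> S. over i}"
proof -
  have fin: "finite S" using assms(1) finite_subset by blast
  show "card (run_maxima f) \<le> card {i \<in> S. over i}"
    by (rule card_run_maxima_le[where y = y])
      (use fin assms(3,4) in \<open>auto simp: orientation_def monotone_along_def split: if_splits\<close>)
  have "card (run_maxima (\<lambda>i. - f i)) \<le> card {i \<in> S. \<not> over i}"
    by (rule card_run_maxima_le[where y = "\<lambda>i. \<not> y i"])
      (use fin assms(3,4) in \<open>auto simp: orientation_def monotone_along_def split: if_splits\<close>)
  then show "card (run_maxima (\<lambda>i. - f i)) \<le> card {i \<in> S. over i}"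
    using mate_closed_card[OF assms(1,2)] by simp
qed

end

section \<open>From knot diagrams to codes\<close>

definition mate :: "diagram \<Rightarrow> nat \<Rightarrow> nat" where
  "mate D i = (THE j. j < num_arcs D \<and> j \<noteq> i \<and> tail_crossing D j = tail_crossing D i)"

context
  fixes D :: diagram
  assumes D: "knot_diagram D"
begin

lemma ex1_mate:
  assumes i: "i < num_arcs D"
  shows "\<exists>!j. j < num_arcs D \<and> j \<noteq> i \<and> tail_crossing D j = tail_crossing D i"
proof -
  have "card {j. j < num_arcs D \<and> tail_crossing D j = tail_crossing D i} = 2"
    using D i by (simp add: knot_diagram_def Let_def crossings_def)
  then obtain a b where "{j. j < num_arcs D \<and> tail_crossing D j = tail_crossing D i} = {a, b}" "a \<noteq> b"
    by (auto simp: card_2_iff)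
  then have ab: "j < num_arcs D \<and> tail_crossing D j = tail_crossing D i \<longleftrightarrow> j = a \<or> j = b" for j
    by auto
  show ?thesis using ab \<open>a \<noteq> b\<close> i by metis
qed

lemma mate_props:
  assumes "i < num_arcs D"
  shows "mate D i < num_arcs D" "mate D i \<noteq> i" "tail_crossing D (mate D i) = tail_crossing D i"
  using theI'[OF ex1_mate[OF assms]] unfolding mate_def by blast+

lemma mate_eqI:
  assumes "i < num_arcs D" "j < num_arcs D" "j \<noteq> i" "tail_crossing D j = tail_crossing D i"
  shows "mate D i = j"
  using ex1_mate[OF assms(1)] mate_props[OF assms(1)] assms(2-4) by metis

lemma over_mate_diagram:
  assumes "i < num_arcs D"
  shows "overarc D (mate D i) = (\<not> overarc D i)"
proof -
  have "\<forall>i<num_arcs D. \<forall>j<num_arcs D. i \<noteq> j \<and> tail_crossing D i = tail_crossing D j \<longrightarrow>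
      overarc D i \<noteq> overarc D j"
    using D unfolding knot_diagram_def Let_def by blast
  then show ?thesis using mate_props[OF assms] assms by metis
qed

lemma gauss_code_diagram:
  assumes "num_crossings D \<ge> 1"
  shows "gauss_code (num_arcs D) (overarc D) (mate D)"
proof
  show "2 \<le> num_arcs D" using assms by (simp add: num_arcs_def)
  show "mate D (mate D i) = i" if "i < num_arcs D" for i
    using mate_props[OF that] that by (intro mate_eqI) auto
qed (use mate_props over_mate_diagram in auto)

lemma height_function_iff:
  assumes "num_crossings D \<ge> 1"
  shows "height_function D f \<longleftrightarrow> gauss_code.height (num_arcs D) (overarc D) (mate D) f"
  unfolding height_function_def gauss_code.height_def[OF gauss_code_diagram[OF assms]]
  using mate_props over_mate_diagram mate_eqI by metis

end

lemma total_variation_eq: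
  assumes "gauss_code (num_arcs D) (overarc D) (mate D)"
  shows "total_variation D f = gauss_code.variation (num_arcs D) f"
  unfolding total_variation_def gauss_code.variation_def[OF assms] gauss_code.nxt_def[OF assms] ..

lemma local_maxima_eq:
  assumes "gauss_code (num_arcs D) (overarc D) (mate D)"
  shows "local_maxima D f = gauss_code.run_maxima (num_arcs D) f"
  unfolding local_maxima_def gauss_code.run_maxima_def[OF assms] gauss_code.prv_def[OF assms] Let_def ..

lemma local_minima_eq:
  assumes "gauss_code (num_arcs D) (overarc D) (mate D)"
  shows "local_minima D f = gauss_code.run_maxima (num_arcs D) (\<lambda>i. - f i)"
  unfolding local_minima_def gauss_code.run_maxima_def[OF assms] gauss_code.prv_def[OF assms] Let_def
  by simp

lemma virtually_alternating_iff:
  assumes "gauss_code (num_arcs D) (overarc D) (mate D)"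
  shows "virtually_alternating D V \<longleftrightarrow>
    gauss_code.alternating (num_arcs D) (overarc D) {i. i < num_arcs D \<and> tail_crossing D i \<notin> V}"
proof -
  have "filter (\<lambda>i. tail_crossing D i \<notin> V) [0..<num_arcs D] =
      filter (\<lambda>i. i \<in> {i. i < num_arcs D \<and> tail_crossing D i \<notin> V}) [0..<num_arcs D]"
    by (rule filter_cong) auto
  then show ?thesis
    unfolding virtually_alternating_def ordinary_passages_def gauss_code.alternating_def[OF assms]
    by simp
qed

text \<open>Every crossing has exactly one overpassage, so \<open>tail_crossing\<close> is a
  bijection from overpassages to crossings. With nothing removed this counts all crossings.\<close>

lemma card_ordinary_overpassages:
  assumes D: "knot_diagram D" and n: "num_crossings D \<ge> 1" and V: "V \<subseteq> crossings D"
  shows "card {i. i < num_arcs D \<and> tail_crossing D i \<notin> V \<and> overarc D i} + card V = num_crossings D"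
proof -
  interpret gauss_code "num_arcs D" "overarc D" "mate D"
    by (rule gauss_code_diagram[OF D n])
  have bij: "bij_betw (tail_crossing D) {i. i < num_arcs D \<and> tail_crossing D i \<notin> W \<and> overarc D i}
      (crossings D - W)" for W
    unfolding bij_betw_def
  proof
    show "inj_on (tail_crossing D) {i. i < num_arcs D \<and> tail_crossing D i \<notin> W \<and> overarc D i}"
      using mate_eqI[OF D] over_mate by (intro inj_onI) (metis (mono_tags) mem_Collect_eq)
    show "tail_crossing D ` {i. i < num_arcs D \<and> tail_crossing D i \<notin> W \<and> overarc D i} =
        crossings D - W" (is "?L = ?R")
    proof
      show "?R \<subseteq> ?L"
      proof
        fix c assume "c \<in> ?R"
        then obtain i where i: "i < num_arcs D" "c = tail_crossing D i" "c \<notin> W"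
          by (auto simp: crossings_def)
        show "c \<in> ?L"
        proof (cases "overarc D i")
          case True
          then show ?thesis using i by blast
        next
          case False
          then have "mate D i \<in> {i. i < num_arcs D \<and> tail_crossing D i \<notin> W \<and> overarc D i}"
            using i mate_props[OF D i(1)] over_mate by simp
          then show ?thesis using i(2) mate_props(3)[OF D i(1)] by (metis image_eqI)
        qed
      qed
    qed (auto simp: crossings_def)
  qed
  have fin: "finite (crossings D)" by (simp add: crossings_def)
  have "card (crossings D) = num_crossings D"
    using bij_betw_same_card[OF bij[of "{}"]] card_over by (simp add: num_arcs_def)
  moreover have "card (crossings D - V) + card V = card (crossings D)"
    using fin V by (metis card_Diff_subset card_mono finite_subset le_add_diff_inverse2)
  ultimately show ?thesis using bij_betw_same_card[OF bij[of V]] by simp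
qed

section \<open>The minimal total variation of a diagram\<close>

theorem proposition8:
  fixes D :: diagram and n k :: nat
  assumes "knot_diagram D"
    and "num_crossings D = n"
    and "n \<ge> 1"
    and "k = (LEAST k. \<exists>V. V \<subseteq> crossings D \<and> card V = k \<and> virtually_alternating D V)"
  shows "(\<forall>f. optimal_height_function D f \<longrightarrow> total_variation D f = 2 * (real n - real k)) \<and>
         (\<exists>f. optimal_height_function D f \<and>
            real (card (local_maxima D f)) \<le> real n - real k \<and>
            real (card (local_minima D f)) \<le> real n - real k)"
proof -
  have n1: "num_crossings D \<ge> 1" using assms(2,3) by simp
  note code = gauss_code_diagram[OF assms(1) n1]
  interpret gauss_code "num_arcs D" "overarc D" "mate D" by (rule code)
  define S where "S V = {i. i < num_arcs D \<and> tail_crossing D i \<notin> V}" for V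
  have S_sub: "S V \<subseteq> {..<num_arcs D}" for V by (auto simp: S_def)
  have S_mate: "mate D i \<in> S V" if "i \<in> S V" for i V
    using that mate_props[OF assms(1)] by (simp add: S_def)
  have alt: "virtually_alternating D V \<longleftrightarrow> (\<exists>y. orientation (S V) y)" for V
    unfolding virtually_alternating_iff[OF code] S_def[symmetric]
    by (rule alternating_iff_orientation[OF S_sub])
  have card_S: "real (card {i \<in> S V. overarc D i}) = real n - real (card V)" if "V \<subseteq> crossings D" for V
    using card_ordinary_overpassages[OF assms(1) n1 that] assms(2) by (simp add: S_def conj_assoc)
  obtain T y f where T: "T \<subseteq> {..<num_arcs D}" "\<And>i. i \<in> T \<Longrightarrow> mate D i \<in> T"
    and y: "orientation T y" and f: "height f"
    "\<And>i. i \<in> T \<Longrightarrow> overarc D i \<Longrightarrow> f i - f (mate D i) = 1" and mono: "monotone_along y f"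
    using optimal_orientation by blast
  \<comment> \<open>The crossings at which the optimal orientation does not turn are virtualized. As
    \<open>T\<close> is closed under \<open>mate\<close>, no crossing has one passage in
    \<open>T\<close> and one outside.\<close>
  define V where "V = tail_crossing D ` ({..<num_arcs D} - T)"
  have V: "V \<subseteq> crossings D" by (auto simp: V_def crossings_def)
  have "i \<notin> T" if "i < num_arcs D" "j < num_arcs D" "j \<notin> T"
    "tail_crossing D i = tail_crossing D j" for i j
    using that T(2) mate_eqI[OF assms(1) that(1,2)] by metis
  then have S_V: "S V = T" using T(1) by (auto simp: S_def V_def)
  let ?P = "\<lambda>k. \<exists>V. V \<subseteq> crossings D \<and> card V = k \<and> virtually_alternating D V"
  have PV: "?P (card V)" using V y alt S_V by metis
  have k_le: "k \<le> card V" unfolding assms(4) by (rule Least_le) (rule PV)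
  have "?P k" unfolding assms(4) by (rule LeastI) (rule PV)
  then obtain V0 y0 where V0: "V0 \<subseteq> crossings D" "card V0 = k" "orientation (S V0) y0"
    using alt by blast
  have lower: "2 * (real n - real k) \<le> total_variation D g" if "height_function D g" for g
    using variation_ge[OF S_sub S_mate V0(3), of g] that card_S[OF V0(1)] V0(2)
    by (simp add: total_variation_eq[OF code] height_function_iff[OF assms(1) n1])
  have card_T: "real (card {i \<in> T. overarc D i}) = real n - real (card V)"
    using card_S[OF V] S_V by simp
  have "total_variation D f = 2 * (real n - real (card V))"
    using variation_eq[OF T y mono f(2)] card_T by (simp add: total_variation_eq[OF code])
  moreover have hf: "height_function D f"
    using f(1) by (simp add: height_function_iff[OF assms(1) n1])
  \<comment> \<open>The lower bound obtained from \<open>V0\<close>, applied to \<open>f\<close>,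
    gives \<open>card V \<le> k\<close>; minimality of \<open>k\<close> gives the converse.\<close>
  ultimately have tv: "total_variation D f = 2 * (real n - real k)" and kV: "card V = k"
    using lower[OF hf] k_le by auto
  have opt: "optimal_height_function D f"
    using hf tv lower by (simp add: optimal_height_function_def)
  have "total_variation D g = 2 * (real n - real k)" if "optimal_height_function D g" for g
    using that lower[of g] hf tv unfolding optimal_height_function_def by force
  moreover have "real (card (local_maxima D f)) \<le> real n - real k"
    "real (card (local_minima D f)) \<le> real n - real k"
    using card_extrema_le[OF T y mono] card_T kV
    by (simp_all add: local_maxima_eq[OF code] local_minima_eq[OF code] flip: of_nat_le_iff[where 'a = real])
  ultimately show ?thesis using opt by blast
qed

end
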